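(* Let $M>0$ and let $F$ be the entire function which extends $$F(s)=\begin{cases} I(s), & s\in\mathbb{C}\setminus\overline{D_M},\\ I(s)-e^{e^{-s^2}}, & s\in D_M,\end{cases}\qquad I(s)=\frac{1}{2\pi i}\int_{\gamma_M}\frac{e^{e^{-\zeta^2}}}{s-\zeta}\,d\zeta .$$ Then $F$ induces a Laplace pair $(f_l,f_r)$ over $\mathbb{C}$ with separatrix $\Re(s)=0$. This Laplace pair is a ghost transition, with $f_r(t)-f_l(t)=f(t)$ for $t \in \mathbb{R}$, where $f$ is the smooth function of $t$ given by $$f(t)=\frac{1}{2\pi i}\int_{\gamma_M}e^{e^{-\zeta^2}}e^{\zeta t}\,d\zeta .$$
   Context: Contour: write $\zeta=\sigma+i\tau$ with $\sigma,\tau\in\mathbb{R}$. For $M>0$, $\gamma_M$ is the contour $$\gamma_M=\left\{\zeta\in\mathbb{C}:|\sigma|=\frac{\pi}{2\tau},\ \tau\ge M\right\}\cup\left\{\zeta\in\mathbb{C}:\tau=M,\ |\sigma|\le\frac{\pi}{2M}\right\},$$ oriented clockwise: it comes down from $+i\infty$ along the right branch $\sigma=\frac{\pi}{2\tau}$, runs along the segment $\tau=M$ from right to left, and goes up to $+i\infty$ along the left branch $\sigma=-\frac{\pi}{2\tau}$. $D_M$ is the open region lying to the right of $\gamma_M$ as it is so traversed, i.e. $D_M=\{\sigma+i\tau:\tau>M,\ |\sigma|<\frac{\pi}{2\tau}\}$. The integral $I$ is holomorphic on $\mathbb{C}\setminus\gamma_M$, the function $F$ defined piecewise on $\mathbb{C}\setminus\gamma_M$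 extends to an entire function, and this entire function does not depend on the choice of $M>0$. Laplace pair: for a locally integrable $g:\mathbb{R}\to\mathbb{C}$ put $\mathcal{L}(g)(s)=\int_{-\infty}^{+\infty}e^{-st}g(t)\,dt$. An entire function $F$ is a Laplace pair $(f_l,f_r)$ over $\mathbb{C}$ with separatrix $\Re(s)=0$ if $f_l,f_r:\mathbb{R}\to\mathbb{C}$ are locally integrable, $F(s)=\mathcal{L}(f_l)(s)$ for all $s$ with $\Re(s)<0$, and $F(s)=\mathcal{L}(f_r)(s)$ for all $s$ with $\Re(s)>0$, the integrals converging there. Ghost transition: a Laplace pair $(f_l,f_r)$ of a function that is holomorphic on the whole strip (here $\mathbb{C}$) is a ghost transition if $f_r-f_l$ is nonzero on a set of positive Lebesgue measure. *)

theory Defs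
  imports "HOL-Complex_Analysis.Complex_Analysis"
begin

definition exp_exp :: "complex \<Rightarrow> complex" where
  "exp_exp z = exp (exp (- (z ^ 2)))"

definition right_branch :: "real \<Rightarrow> complex" where
  "right_branch \<tau> = Complex (pi / (2 * \<tau>)) \<tau>"

definition left_branch :: "real \<Rightarrow> complex" where
  "left_branch \<tau> = Complex (- pi / (2 * \<tau>)) \<tau>"

definition base_segment :: "real \<Rightarrow> real \<Rightarrow> complex" where
  "base_segment M = linepath (right_branch M) (left_branch M)"

text \<open>
  The contour consists of two unbounded branches, both parametrised upwards by the imaginary part
  on \<open>{M..}\<close>, and the segment between their end points.  The notion of contour integral in the
  library covers only paths on the unit interval; on a branch we use the same formula (with the
  Henstock--Kurzweil integral, so improper convergence is included) on the half-line.
\<close>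

definition branch_integrable :: "real \<Rightarrow> (real \<Rightarrow> complex) \<Rightarrow> (complex \<Rightarrow> complex) \<Rightarrow> bool" where
  "branch_integrable M p h \<longleftrightarrow>
     (\<lambda>\<tau>. h (p \<tau>) * vector_derivative p (at \<tau>)) integrable_on {M..}"

definition branch_integral :: "real \<Rightarrow> (real \<Rightarrow> complex) \<Rightarrow> (complex \<Rightarrow> complex) \<Rightarrow> complex" where
  "branch_integral M p h = integral {M..} (\<lambda>\<tau>. h (p \<tau>) * vector_derivative p (at \<tau>))"

definition gamma_integrable :: "real \<Rightarrow> (complex \<Rightarrow> complex) \<Rightarrow> bool" where
  "gamma_integrable M h \<longleftrightarrow>
     branch_integrable M right_branch h \<and> h contour_integrable_on (base_segment M) \<and>
     branch_integrable M left_branch h"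

text \<open>The minus sign is the orientation: the right branch is traversed downwards.\<close>

definition gamma_integral :: "real \<Rightarrow> (complex \<Rightarrow> complex) \<Rightarrow> complex" where
  "gamma_integral M h =
     - branch_integral M right_branch h + contour_integral (base_segment M) h
     + branch_integral M left_branch h"

definition D_region :: "real \<Rightarrow> complex set" where
  "D_region M = {z. Im z > M \<and> \<bar>Re z\<bar> < pi / (2 * Im z)}"

definition I_integral :: "real \<Rightarrow> complex \<Rightarrow> complex" where
  "I_integral M s =
     1 / (2 * of_real pi * \<i>) * gamma_integral M (\<lambda>\<zeta>. exp_exp \<zeta> / (s - \<zeta>))"

definition jump_function :: "real \<Rightarrow> real \<Rightarrow> complex" where
  "jump_function M t =
     1 / (2 * of_real pi * \<i>) * gamma_integral M (\<lambda>\<zeta>. exp_exp \<zeta> * exp (\<zeta> * of_real t))"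

text \<open>On the contour itself nothing is prescribed: the values of \<open>F\<close> there are determined by
  continuity.\<close>

definition entire_extension :: "real \<Rightarrow> (complex \<Rightarrow> complex) \<Rightarrow> bool" where
  "entire_extension M F \<longleftrightarrow>
     F holomorphic_on UNIV \<and>
     (\<forall>s \<in> - closure (D_region M). F s = I_integral M s) \<and>
     (\<forall>s \<in> D_region M. F s = I_integral M s - exp_exp s)"

definition smooth :: "(real \<Rightarrow> complex) \<Rightarrow> bool" where
  "smooth g \<longleftrightarrow>
     (\<forall>n. (((\<lambda>k t. vector_derivative k (at t)) ^^ n) g) differentiable_on UNIV)"

definition locally_integrable :: "(real \<Rightarrow> complex) \<Rightarrow> bool" where
  "locally_integrable g \<longleftrightarrow> (\<forall>K. compact K \<longrightarrow> g absolutely_integrable_on K)"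

definition laplace_converges :: "(real \<Rightarrow> complex) \<Rightarrow> complex \<Rightarrow> bool" where
  "laplace_converges g s \<longleftrightarrow> integrable lebesgue (\<lambda>t. exp (- s * of_real t) * g t)"

definition laplace :: "(real \<Rightarrow> complex) \<Rightarrow> complex \<Rightarrow> complex" where
  "laplace g s = (LINT t|lebesgue. exp (- s * of_real t) * g t)"

definition laplace_pair ::
  "(complex \<Rightarrow> complex) \<Rightarrow> (real \<Rightarrow> complex) \<Rightarrow> (real \<Rightarrow> complex) \<Rightarrow> bool" where
  "laplace_pair F f_l f_r \<longleftrightarrow>
     F holomorphic_on UNIV \<and> locally_integrable f_l \<and> locally_integrable f_r \<and>
     (\<forall>s. Re s < 0 \<longrightarrow> laplace_converges f_l s \<and> F s = laplace f_l s) \<and>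
     (\<forall>s. Re s > 0 \<longrightarrow> laplace_converges f_r s \<and> F s = laplace f_r s)"

definition ghost_transition ::
  "(complex \<Rightarrow> complex) \<Rightarrow> (real \<Rightarrow> complex) \<Rightarrow> (real \<Rightarrow> complex) \<Rightarrow> bool" where
  "ghost_transition F f_l f_r \<longleftrightarrow>
     laplace_pair F f_l f_r \<and> emeasure lebesgue {t. f_r t - f_l t \<noteq> 0} > 0"

end

theory Submission imports Defs begin

text \<open>
  On both branches \<open>\<zeta>\<^sup>2\<close> has imaginary part \<open>\<plusminus>\<pi>\<close>, so \<open>exp (- \<zeta>\<^sup>2)\<close> is negative real and the integrand
  decays doubly exponentially; hence the jump function \<open>J\<close> is the restriction of an entire function
  to the real line.  For \<open>Re s > \<pi> / (2 M)\<close>, writing \<open>1 / (s - \<zeta>)\<close> as the Laplace integral of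
  \<open>exp (\<zeta> t)\<close> over \<open>t > 0\<close> and applying Fubini shows that \<open>F(s)\<close> is the Laplace transform of \<open>J\<close> on \<open>t > 0\<close>.  As \<open>J\<close> does not depend
  on \<open>M\<close> (entire functions have primitives), \<open>J(t) = O(exp (c t))\<close> for every \<open>c > 0\<close>, and the identity
  extends to \<open>Re s > 0\<close> by analytic continuation.  The left half-plane is the mirror image.  If \<open>J\<close>
  vanished almost everywhere, then \<open>F = 0\<close>, so \<open>exp (exp \<sigma>\<^sup>2) = I(i \<sigma>)\<close> for large \<open>\<sigma>\<close>; but \<open>i \<sigma>\<close> has
  distance at least \<open>1 / (\<sigma> + 1)\<close> from the contour, so that \<open>I(i \<sigma>) = O(\<sigma>)\<close>.
\<close>

section \<open>Parameter integrals and Laplace transforms\<close>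

text \<open>Only the integrand is dominated, not its derivative. Cauchy's inequality on discs of
  radius \<open>r/2\<close> turns the majorant \<open>B\<close> into \<open>B x / (r/2)\<close> for
  the derivative, and the mean value inequality passes this bound on to the difference
  quotients.\<close>

lemma holomorphic_on_parameter_integral:
  fixes g :: "complex \<Rightarrow> 'a \<Rightarrow> complex"
  assumes hol: "\<And>x. x \<in> space M \<Longrightarrow> (\<lambda>z. g z x) holomorphic_on S"
    and meas: "\<And>z. z \<in> S \<Longrightarrow> g z \<in> borel_measurable M"
    and dom: "\<And>z. z \<in> S \<Longrightarrow> \<exists>r>0. \<exists>B. cball z r \<subseteq> S \<and> integrable M B \<and>
                 (\<forall>w\<in>cball z r. \<forall>x\<in>space M. norm (g w x) \<le> B x)"
  shows "(\<lambda>z. \<integral>x. g z x \<partial>M) holomorphic_on S"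
  unfolding holomorphic_on_def
proof
  fix z assume z: "z \<in> S"
  obtain r B where r: "r > 0" "cball z r \<subseteq> S" and B: "integrable M B"
    and gB: "\<And>w x. w \<in> cball z r \<Longrightarrow> x \<in> space M \<Longrightarrow> norm (g w x) \<le> B x"
    using dom[OF z] by meson
  \<comment> \<open>The radius is halved so that every disc of radius \<open>r/2\<close> about a
    point of \<open>U\<close> stays inside \<open>cball z r\<close>, where \<open>B\<close>
    dominates.\<close>
  define U where "U = ball z (r/2)"
  have zU: "z \<in> U" and U: "open U" "U \<subseteq> cball z r"
    using r by (auto simp: U_def)
  have int: "integrable M (g w)" if "w \<in> cball z r" for w
  proof (rule Bochner_Integration.integrable_bound[OF B])
    show "g w \<in> borel_measurable M" using meas that r by auto
    show "AE x in M. norm (g w x) \<le> norm (B x)"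
      using gB[OF that] by (intro AE_I2) (smt (verit) real_norm_def)
  qed
  have hc: "(\<lambda>z. g z x) holomorphic_on cball z r" if "x \<in> space M" for x
    using holomorphic_on_subset[OF hol[OF that] r(2)] .
  have der: "((\<lambda>z. g z x) has_field_derivative deriv (\<lambda>z. g z x) w) (at w)"
    if "x \<in> space M" "w \<in> U" for x w
  proof (rule holomorphic_derivI)
    show "(\<lambda>z. g z x) holomorphic_on ball z r"
      using hc[OF that(1)] by (rule holomorphic_on_subset) auto
    show "w \<in> ball z r" using that(2) r by (auto simp: U_def)
  qed auto
  have der_bound: "norm (deriv (\<lambda>z. g z x) w) \<le> B x / (r/2)"
    if x: "x \<in> space M" and w: "w \<in> U" for x w
  proof -
    have sub: "cball w (r/2) \<subseteq> cball z r"
    proof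
      fix v assume "v \<in> cball w (r/2)"
      with w show "v \<in> cball z r"
        using dist_triangle[of z v w] by (auto simp: U_def)
    qed
    have "norm ((deriv ^^ 1) (\<lambda>z. g z x) w) \<le> fact 1 * B x / (r/2)^1"
    proof (rule Cauchy_inequality)
      show "(\<lambda>z. g z x) holomorphic_on ball w (r/2)"
        using hc[OF x] by (rule holomorphic_on_subset) (use sub in auto)
      show "continuous_on (cball w (r/2)) (\<lambda>z. g z x)"
        using hc[OF x] sub by (meson holomorphic_on_imp_continuous_on holomorphic_on_subset)
      show "norm (g v x) \<le> B x" if "norm (w - v) = r/2" for v
        using that sub x by (intro gB) (auto simp: dist_norm subset_iff)
    qed (use r in auto)
    then show ?thesis by simp
  qed
  define D where "D = (\<lambda>x. deriv (\<lambda>z. g z x) z)"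
  \<comment> \<open>The limit is tested along sequences, the form in which dominated convergence
    applies; \<open>D\<close> is then measurable as a pointwise limit of the quotients
    \<open>q\<close>.\<close>
  have "((\<lambda>z. \<integral>x. g z x \<partial>M) has_field_derivative (\<integral>x. D x \<partial>M)) (at z within U)"
    unfolding has_field_derivative_iff tendsto_at_iff_sequentially
  proof (intro allI impI)
    fix X assume XU: "\<forall>i. X i \<in> U - {z}" and X: "X \<longlonglongrightarrow> z"
    have XU': "X i \<in> U" "X i \<noteq> z" for i using XU by auto
    define q where "q = (\<lambda>i x. (g (X i) x - g z x) / (X i - z))"
    have qlim: "(\<lambda>i. q i x) \<longlonglongrightarrow> D x" if "x \<in> space M" for x
    proof -
      have "((\<lambda>y. (g y x - g z x) / (y - z)) \<longlongrightarrow> D x) (at z within U)"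
        using has_field_derivative_at_within[OF der[OF that zU], of U]
        unfolding has_field_derivative_iff D_def .
      then show ?thesis
        unfolding tendsto_at_iff_sequentially using XU X by (auto simp: o_def q_def)
    qed
    have qm[measurable]: "q i \<in> borel_measurable M" for i
      unfolding q_def using int[of "X i"] int[of z] XU'[of i] U r
      by (intro borel_measurable_divide borel_measurable_diff borel_measurable_integrable) auto
    have "(\<lambda>i. \<integral>x. q i x \<partial>M) \<longlonglongrightarrow> (\<integral>x. D x \<partial>M)"
    proof (rule integral_dominated_convergence)
      show "D \<in> borel_measurable M"
        by (rule borel_measurable_LIMSEQ_metric[of q]) (use qm qlim in auto)
      show "integrable M (\<lambda>x. B x / (r/2))" using B by auto
      show "AE x in M. (\<lambda>i. q i x) \<longlonglongrightarrow> D x" using qlim by auto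
      show "AE x in M. norm (q i x) \<le> B x / (r/2)" for i
      proof (rule AE_I2)
        fix x assume x: "x \<in> space M"
        have "norm (g (X i) x - g z x) \<le> B x / (r/2) * norm (X i - z)"
        proof (rule field_differentiable_bound[of U "\<lambda>z. g z x" "deriv (\<lambda>z. g z x)"])
          show "convex U" by (auto simp: U_def)
          show "((\<lambda>z. g z x) has_field_derivative deriv (\<lambda>z. g z x) w) (at w within U)"
            if "w \<in> U" for w using der[OF x that] by (rule has_field_derivative_at_within)
          show "norm (deriv (\<lambda>z. g z x) w) \<le> B x / (r/2)" if "w \<in> U" for w
            using der_bound[OF x that] .
        qed (use XU' zU in auto)
        then show "norm (q i x) \<le> B x / (r/2)"
          using XU'(2)[of i] by (simp add: q_def norm_divide pos_divide_le_eq)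
      qed
    qed measurable
    moreover have "(\<integral>x. q i x \<partial>M) = ((\<integral>x. g (X i) x \<partial>M) - (\<integral>x. g z x \<partial>M)) / (X i - z)" for i
      unfolding q_def using int[of "X i"] int[of z] XU'[of i] U r by (subst integral_divide_zero) (auto intro!: Bochner_Integration.integral_diff)
    ultimately show "((\<lambda>y. ((\<integral>x. g y x \<partial>M) - (\<integral>x. g z x \<partial>M)) / (y - z)) \<circ> X) \<longlonglongrightarrow> (\<integral>x. D x \<partial>M)"
      by (simp add: o_def)
  qed
  then have "(\<lambda>z. \<integral>x. g z x \<partial>M) field_differentiable (at z)"
    using at_within_open[OF zU U(1)] by (auto simp: field_differentiable_def)
  then show "(\<lambda>z. \<integral>x. g z x \<partial>M) field_differentiable (at z within S)"
    by (rule field_differentiable_at_within)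
qed

section \<open>Laplace integrals of exponentials over the positive half-line\<close>

lemma exp_halfline_real:
  assumes "a > (0::real)"
  shows "integrable lborel (\<lambda>t. indicator {0<..} t *\<^sub>R exp (- a * t))"
proof -
  have "(\<lambda>t. exp (- a * t)) absolutely_integrable_on {0..}"
    using assms by (intro nonnegative_absolutely_integrable_1 integrable_on_exp_minus_to_infinity) auto
  then have "(\<lambda>t. exp (- a * t)) absolutely_integrable_on {0<..}"
    by (rule set_integrable_subset) auto
  then show ?thesis
    unfolding set_integrable_def by (subst (asm) integrable_completion) auto
qed

text \<open>With \<open>z = s - p x\<close> this turns the Cauchy kernel
  \<open>1 / (s - p x)\<close> into an integral over \<open>t > 0\<close>.\<close>

lemma exp_halfline_complex:
  assumes "Re z > 0"
  shows "integrable lborel (\<lambda>t. indicator {0<..} t *\<^sub>R exp (- z * of_real t))"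
    and "(\<integral>t. indicator {0<..} t *\<^sub>R exp (- z * of_real t) \<partial>lborel) = 1 / z"
proof -
  show int: "integrable lborel (\<lambda>t. indicator {0<..} t *\<^sub>R exp (- z * of_real t))"
    by (rule Bochner_Integration.integrable_bound[OF exp_halfline_real[OF assms]])
       (auto simp: indicator_def)
  have z: "z \<noteq> 0" using assms by auto
  define P where "P = (\<lambda>t::real. - exp (- z * of_real t) / z)"
  have P: "(P has_vector_derivative exp (- z * of_real t)) (at t within A)" for t A
  proof -
    have "((\<lambda>w. - exp (- z * w) / z) has_field_derivative exp (- z * of_real t)) (at (of_real t))"
      using z by (auto intro!: derivative_eq_intros)
    then show ?thesis unfolding P_def by (rule has_vector_derivative_real_field)
  qed
  have lim0: "(P \<longlongrightarrow> - 1 / z) (at_right 0)"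
    unfolding P_def using z by (auto intro!: tendsto_eq_intros)
  have liminf: "(P \<longlongrightarrow> 0) at_top"
  proof (rule tendsto_norm_zero_cancel)
    have "((\<lambda>t. exp (- Re z * t) / norm z) \<longlongrightarrow> 0 / norm z) at_top"
    proof (intro tendsto_intros)
      have "filterlim (\<lambda>t. Re z * t) at_top at_top"
        using filterlim_tendsto_pos_mult_at_top[OF tendsto_const assms filterlim_ident] .
      then show "((\<lambda>t. exp (- Re z * t)) \<longlongrightarrow> 0) at_top"
        by (intro filterlim_compose[OF exp_at_bot]) (simp add: filterlim_uminus_at_bot)
    qed (use z in auto)
    then show "((\<lambda>t. norm (P t)) \<longlongrightarrow> 0) at_top" by (simp add: P_def norm_divide)
  qed
  have "(LBINT t=0..\<infinity>. exp (- z * of_real t)) = 0 - (- 1 / z)"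
  proof (rule interval_integral_FTC_integrable)
    show "(P has_vector_derivative exp (- z * of_real t)) (at t)" for t by (rule P)
    show "set_integrable lborel (einterval 0 \<infinity>) (\<lambda>t. exp (- z * of_real t))"
      using int by (simp add: set_integrable_def zero_ereal_def)
    show "((P \<circ> real_of_ereal) \<longlongrightarrow> - 1 / z) (at_right 0)"
      using lim0 by (simp add: zero_ereal_def ereal_tendsto_simps)
    show "((P \<circ> real_of_ereal) \<longlongrightarrow> 0) (at_left \<infinity>)"
      using liminf by (simp add: ereal_tendsto_simps)
  qed auto
  then show "(\<integral>t. indicator {0<..} t *\<^sub>R exp (- z * of_real t) \<partial>lborel) = 1 / z"
    by (simp add: interval_lebesgue_integral_def set_lebesgue_integral_def zero_ereal_def)
qed

text \<open>Fubini for \<open>G\<close>: integrating over \<open>x\<close> first leaves the Laplace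
  integrand, integrating over \<open>t\<close> first leaves the Cauchy kernel. The majorant is a
  product of a function of \<open>x\<close> and one of \<open>t\<close>. The bound on
  \<open>Re (p x)\<close> is asked only where \<open>k x\<close> is nonzero, because the tracks used
  later can leave the contour where their weight vanishes.\<close>

lemma laplace_exp_average:
  fixes k p :: "real \<Rightarrow> complex"
  assumes k: "integrable lborel k" and p[measurable]: "p \<in> borel_measurable borel"
    and Re_p: "\<And>x. k x \<noteq> 0 \<Longrightarrow> Re (p x) \<le> c" and s: "c < Re s"
  shows "integrable lborel (\<lambda>t. indicator {0<..} t *\<^sub>R
            (exp (- s * of_real t) * (\<integral>x. k x * exp (p x * of_real t) \<partial>lborel)))"
    and "(\<integral>t. indicator {0<..} t *\<^sub>R
            (exp (- s * of_real t) * (\<integral>x. k x * exp (p x * of_real t) \<partial>lborel)) \<partial>lborel)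
         = (\<integral>x. k x / (s - p x) \<partial>lborel)"
proof -
  have km[measurable]: "k \<in> borel_measurable borel" using k by auto
  define G where "G = (\<lambda>x t. k x * (indicator {0<..} t *\<^sub>R exp (- (s - p x) * of_real t)))"
  have G_le: "norm (G x t) \<le> norm (k x) * (indicator {0<..} t * exp (- (Re s - c) * t))" for x t
  proof (cases "k x = 0 \<or> t \<le> 0")
    case False
    then have "Re (p x) * t \<le> c * t" using Re_p by (intro mult_right_mono) auto
    with False show ?thesis
      by (auto simp: G_def norm_mult algebra_simps)
  qed (auto simp: G_def)
  have e: "integrable lborel (\<lambda>t. indicator {0<..} t * exp (- (Re s - c) * t))"
    using exp_halfline_real[of "Re s - c"] s by simp
  have "integrable (lborel \<Otimes>\<^sub>M lborel) (case_prod (\<lambda>x t. norm (k x) * (indicator {0<..} t * exp (- (Re s - c) * t))))"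
  proof (rule lborel_pair.Fubini_integrable)
    show "integrable lborel (\<lambda>x. \<integral>t. norm (case (x, t) of (x, t) \<Rightarrow> norm (k x) * (indicator {0<..} t * exp (- (Re s - c) * t))) \<partial>lborel)"
      using k by (simp add: abs_mult)
    show "AE x in lborel. integrable lborel (\<lambda>t. case (x, t) of (x, t) \<Rightarrow> norm (k x) * (indicator {0<..} t * exp (- (Re s - c) * t)))"
      using e by (intro AE_I2) simp
  qed measurable
  then have G: "integrable (lborel \<Otimes>\<^sub>M lborel) (case_prod G)"
  proof (rule Bochner_Integration.integrable_bound)
    show "case_prod G \<in> borel_measurable (lborel \<Otimes>\<^sub>M lborel)"
      unfolding G_def by measurable
    show "AE x in lborel \<Otimes>\<^sub>M lborel. norm (case_prod G x)
        \<le> norm (case x of (x, t) \<Rightarrow> norm (k x) * (indicat_real {0<..} t * exp (- (Re s - c) * t)))"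
      using G_le by (intro AE_I2) (auto simp: abs_mult)
  qed
  have inner: "(\<integral>x. G x t \<partial>lborel) = indicator {0<..} t *\<^sub>R
            (exp (- s * of_real t) * (\<integral>x. k x * exp (p x * of_real t) \<partial>lborel))" for t
  proof -
    have "G x t = (indicator {0<..} t *\<^sub>R exp (- s * of_real t)) * (k x * exp (p x * of_real t))" for x
      by (simp add: G_def exp_add[symmetric] algebra_simps)
    then show ?thesis by simp
  qed
  have outer: "(\<integral>t. G x t \<partial>lborel) = k x / (s - p x)" for x
  proof (cases "k x = 0")
    case False
    then have "Re (s - p x) > 0" using Re_p[of x] s by auto
    show ?thesis
      unfolding G_def integral_mult_right_zero exp_halfline_complex(2)[OF \<open>Re (s - p x) > 0\<close>] by simp
  qed (simp add: G_def)
  show "integrable lborel (\<lambda>t. indicator {0<..} t *\<^sub>R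
            (exp (- s * of_real t) * (\<integral>x. k x * exp (p x * of_real t) \<partial>lborel)))"
    using lborel_pair.integrable_snd[OF G] by (simp only: inner)
  show "(\<integral>t. indicator {0<..} t *\<^sub>R
            (exp (- s * of_real t) * (\<integral>x. k x * exp (p x * of_real t) \<partial>lborel)) \<partial>lborel)
         = (\<integral>x. k x / (s - p x) \<partial>lborel)"
    using lborel_pair.Fubini_integral[OF G] by (simp only: inner outer)
qed

section \<open>Laplace transforms of Borel functions that vanish for negative time\<close>

lemma laplace_converges_iff_lborel:
  "g \<in> borel_measurable borel \<Longrightarrow>
    laplace_converges g s \<longleftrightarrow> integrable lborel (\<lambda>t. exp (- s * of_real t) * g t)"
  unfolding laplace_converges_def by (subst integrable_completion) auto

lemma laplace_eq_lborel:
  "g \<in> borel_measurable borel \<Longrightarrow> laplace g s = (\<integral>t. exp (- s * of_real t) * g t \<partial>lborel)"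
  unfolding laplace_def by (subst integral_completion) auto

text \<open>Taking the growth rate \<open>c = Re s / 2\<close> spends half of the decay of the
  kernel and leaves \<open>exp (- (Re s / 2) * t)\<close> as majorant.\<close>

lemma laplace_converges_halfplane:
  assumes [measurable]: "f \<in> borel_measurable borel"
    and neg: "\<And>t. t < 0 \<Longrightarrow> f t = 0"
    and growth: "\<And>c. c > 0 \<Longrightarrow> \<exists>C. \<forall>t>0. norm (f t) \<le> C * exp (c * t)"
    and s: "Re s > 0"
  shows "laplace_converges f s"
proof -
  obtain C where C: "\<And>t. t > 0 \<Longrightarrow> norm (f t) \<le> C * exp (Re s / 2 * t)"
    using growth[of "Re s / 2"] s by auto
  have "integrable lborel (\<lambda>t. exp (- s * of_real t) * f t)"
  proof (rule Bochner_Integration.integrable_bound)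
    show "integrable lborel (\<lambda>t. C * (indicator {0<..} t *\<^sub>R exp (- (Re s / 2) * t)))"
      by (intro integrable_mult_right exp_halfline_real) (use s in auto)
    \<comment> \<open>The hypotheses do not control \<open>f 0\<close>, so the origin is discarded
      as a null set.\<close>
    have "AE t in lborel. t \<noteq> (0::real)"
      by (rule AE_lborel_singleton)
    then show "AE t in lborel. norm (exp (- s * of_real t) * f t)
        \<le> norm (C * (indicator {0<..} t *\<^sub>R exp (- (Re s / 2) * t)))"
    proof eventually_elim
      case (elim t)
      show ?case
      proof (cases "t > 0")
        case True
        have "norm (exp (- s * of_real t) * f t) \<le> exp (- Re s * t) * (C * exp (Re s / 2 * t))"
          using C[OF True] by (auto simp: norm_mult)
        also have "\<dots> = C * exp (- (Re s / 2) * t)"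
          by (simp add: exp_add[symmetric] field_simps)
        also have "\<dots> \<le> \<bar>C\<bar> * exp (- (Re s / 2) * t)" by (intro mult_right_mono) auto
        finally show ?thesis using True by (simp add: abs_mult)
      next
        case False
        with elim neg[of t] show ?thesis by auto
      qed
    qed
  qed measurable
  then show ?thesis by (subst laplace_converges_iff_lborel) auto
qed

lemma holomorphic_on_laplace:
  assumes [measurable]: "f \<in> borel_measurable borel"
    and neg: "\<And>t. t < 0 \<Longrightarrow> f t = 0"
    and conv: "\<And>s. Re s > 0 \<Longrightarrow> laplace_converges f s"
  shows "laplace f holomorphic_on {s. Re s > 0}"
proof -
  have "(\<lambda>s. \<integral>t. exp (- s * of_real t) * f t \<partial>lborel) holomorphic_on {s. Re s > 0}"
  proof (rule holomorphic_on_parameter_integral)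
    fix s assume "s \<in> {s. Re s > 0}"
    then have s: "Re s > 0" by simp
    \<comment> \<open>On the disc of this radius \<open>Re w\<close> is at least \<open>r\<close>,
      so for nonnegative \<open>t\<close> the integrand at \<open>w\<close> is bounded by the one at
      the real point \<open>r\<close>, which is integrable by \<open>conv\<close>.\<close>
    define r where "r = Re s / 2"
    have r: "r > 0" using s by (simp add: r_def)
    have near: "Re w \<ge> r" if "w \<in> cball s r" for w
      using that abs_Re_le_cmod[of "s - w"] by (auto simp: dist_norm r_def abs_if split: if_splits)
    show "\<exists>r>0. \<exists>B. cball s r \<subseteq> {s. 0 < Re s} \<and> integrable lborel B \<and>
            (\<forall>w\<in>cball s r. \<forall>t\<in>space lborel. norm (exp (- w * of_real t) * f t) \<le> B t)"
    proof (intro exI conjI ballI)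
      show "0 < r" by fact
      show "cball s r \<subseteq> {s. 0 < Re s}" using near r by fastforce
      show "integrable lborel (\<lambda>t. norm (exp (- of_real r * of_real t) * f t))"
        using conv[of "of_real r"] r by (simp add: laplace_converges_iff_lborel)
      fix w t assume w: "w \<in> cball s r"
      show "norm (exp (- w * of_real t) * f t) \<le> norm (exp (- of_real r * of_real t) * f t)"
        using near[OF w] neg[of t]
        by (cases "t < 0") (auto simp: norm_mult intro!: mult_right_mono)
    qed
  qed (auto intro!: holomorphic_intros)
  then show ?thesis by (simp add: laplace_eq_lborel[OF assms(1), abs_def])
qed

text \<open>Subexponential growth makes the transform holomorphic on the whole right half-plane, so
  an identity known only far to the right spreads by the identity theorem.\<close>

lemma laplace_identity_halfplane:
  assumes f: "f \<in> borel_measurable borel" "\<And>t. t < 0 \<Longrightarrow> f t = 0"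
    and growth: "\<And>c. c > 0 \<Longrightarrow> \<exists>C. \<forall>t>0. norm (f t) \<le> C * exp (c * t)"
    and F: "F holomorphic_on UNIV" "\<And>s. Re s > a \<Longrightarrow> F s = laplace f s"
    and s: "Re s > 0"
  shows "laplace_converges f s" "F s = laplace f s"
proof -
  have conv: "laplace_converges f s" if "Re s > 0" for s
    using laplace_converges_halfplane[OF f growth that] .
  show "laplace_converges f s" using conv[OF s] .
  \<comment> \<open>The maximum keeps the smaller half-plane inside the larger one when
    \<open>a\<close> is negative.\<close>
  show "F s = laplace f s"
  proof (rule analytic_continuation_open[of "{s. Re s > max a 0}" "{s. Re s > 0}" F "laplace f"])
    show "{s. Re s > max a 0} \<noteq> {}"
      by (auto intro!: exI[of _ "of_real (max a 0 + 1)"])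
    show "connected {s. Re s > 0}"
      by (intro convex_connected convex_halfspace_Re_gt)
    show "F holomorphic_on {s. Re s > 0}" using F(1) by (rule holomorphic_on_subset) auto
    show "laplace f holomorphic_on {s. Re s > 0}"
      using holomorphic_on_laplace[OF f conv] .
    show "open {s. Re s > max a 0}" "open {s. Re s > 0}" by (rule open_halfspace_Re_gt)+
  qed (use F(2) s in auto)
qed

section \<open>The contour as a finite sum of weighted curves\<close>

definition right_tangent :: "real \<Rightarrow> complex" where
  "right_tangent \<tau> = Complex (- pi / (2 * \<tau>\<^sup>2)) 1"

definition left_tangent :: "real \<Rightarrow> complex" where
  "left_tangent \<tau> = Complex (pi / (2 * \<tau>\<^sup>2)) 1"

lemma right_branch_has_vector_derivative:
  assumes "\<tau> > 0"
  shows "(right_branch has_vector_derivative right_tangent \<tau>) (at \<tau> within A)"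
proof -
  have "((\<lambda>\<tau>. pi / (2 * \<tau>)) has_real_derivative - pi / (2 * \<tau>\<^sup>2)) (at \<tau> within A)"
    using assms by (auto intro!: derivative_eq_intros simp: field_simps power2_eq_square)
  then show ?thesis
    unfolding right_branch_def right_tangent_def has_vector_derivative_complex_iff by simp
qed

text \<open>Reflection in the imaginary axis: it commutes with \<open>exp_exp\<close> up to
  conjugation and preserves norms, so the facts about the left branch come from those about the
  right one.\<close>

lemma left_branch_eq: "left_branch \<tau> = - cnj (right_branch \<tau>)"
  and left_tangent_eq: "left_tangent \<tau> = - cnj (right_tangent \<tau>)"
  by (simp_all add: complex_eq_iff left_branch_def right_branch_def left_tangent_def right_tangent_def)

lemma left_branch_has_vector_derivative:
  assumes "\<tau> > 0"
  shows "(left_branch has_vector_derivative left_tangent \<tau>) (at \<tau> within A)"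
  unfolding left_branch_eq left_tangent_eq
  by (intro derivative_intros has_vector_derivative_cnj right_branch_has_vector_derivative assms)

lemma exp_exp_right_branch:
  assumes "\<tau> > 0"
  shows "exp_exp (right_branch \<tau>) = of_real (exp (- exp (\<tau>\<^sup>2 - (pi / (2 * \<tau>))\<^sup>2)))"
proof -
  have "- (right_branch \<tau> ^ 2) = of_real (\<tau>\<^sup>2 - (pi / (2 * \<tau>))\<^sup>2) + - (of_real pi * \<i>)"
    using assms by (simp add: right_branch_def complex_eq_iff power2_eq_square)
  then have "exp (- (right_branch \<tau> ^ 2)) = - of_real (exp (\<tau>\<^sup>2 - (pi / (2 * \<tau>))\<^sup>2))"
    by (simp add: exp_diff exp_of_real del: of_real_diff)
  then show ?thesis by (simp add: exp_exp_def flip: exp_of_real)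
qed

lemma exp_exp_left_branch:
  assumes "\<tau> > 0"
  shows "exp_exp (left_branch \<tau>) = of_real (exp (- exp (\<tau>\<^sup>2 - (pi / (2 * \<tau>))\<^sup>2)))"
proof -
  have "exp_exp (- cnj z) = cnj (exp_exp z)" for z
    by (simp add: exp_exp_def exp_cnj)
  then show ?thesis
    by (simp only: left_branch_eq exp_exp_right_branch[OF assms] complex_cnj_complex_of_real)
qed

lemma holomorphic_on_exp_exp [holomorphic_intros]:
  "g holomorphic_on A \<Longrightarrow> (\<lambda>z. exp_exp (g z)) holomorphic_on A"
  unfolding exp_exp_def by (intro holomorphic_intros)

lemma borel_measurable_exp_exp [measurable]: "exp_exp \<in> borel_measurable borel"
  by (intro borel_measurable_continuous_onI holomorphic_on_imp_continuous_on holomorphic_intros)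

lemma borel_measurable_branches [measurable]:
  "right_branch \<in> borel_measurable borel" "left_branch \<in> borel_measurable borel"
  "right_tangent \<in> borel_measurable borel" "left_tangent \<in> borel_measurable borel"
  unfolding right_branch_def left_branch_def right_tangent_def left_tangent_def
  by (subst borel_measurable_complex_iff; simp)+

lemma borel_measurable_base_segment [measurable]: "base_segment M \<in> borel_measurable borel"
  unfolding base_segment_def by (intro borel_measurable_continuous_onI continuous_on_linepath)

text \<open>The indices 0, 1, 2 are the right branch, the segment and the left branch.  The weight collects
  the orientation, the parameter range, the tangent vector and the factor \<^term>\<open>exp_exp\<close>.\<close>

definition track :: "real \<Rightarrow> nat \<Rightarrow> real \<Rightarrow> complex" where
  "track M i = (if i = 0 then right_branch else if i = 1 then base_segment M else left_branch)"

definition weight :: "real \<Rightarrow> nat \<Rightarrow> real \<Rightarrow> complex" where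
  "weight M i x =
     (if i = 0 then - (indicator {M..} x *\<^sub>R (exp_exp (right_branch x) * right_tangent x))
      else if i = 1 then indicator {0..1} x *\<^sub>R (exp_exp (base_segment M x) * (left_branch M - right_branch M))
      else indicator {M..} x *\<^sub>R (exp_exp (left_branch x) * left_tangent x))"

text \<open>The indicators in the weights make all three pieces Lebesgue integrals over the whole
  line, so Fubini and the estimates are carried out once for a general index. The link to the
  contour integral is \<open>gamma_integral_exp_exp\<close>.\<close>

definition gamma_average :: "real \<Rightarrow> (complex \<Rightarrow> complex) \<Rightarrow> complex" where
  "gamma_average M h = (\<Sum>i<3. \<integral>x. weight M i x * h (track M i x) \<partial>lborel)"

definition contour :: "real \<Rightarrow> complex set" where
  "contour M = right_branch ` {M..} \<union> closed_segment (right_branch M) (left_branch M) \<union> left_branch ` {M..}"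

section \<open>Measurability of the weighted curves and position of the contour\<close>

lemma borel_measurable_track [measurable]: "track M i \<in> borel_measurable borel"
  unfolding track_def by auto

lemma borel_measurable_weight [measurable]: "weight M i \<in> borel_measurable borel"
proof -
  consider "i = 0" | "i = 1" | "i \<noteq> 0" "i \<noteq> 1" by auto
  then show ?thesis unfolding weight_def[abs_def] by cases simp_all
qed

lemma track_in_contour: "weight M i x \<noteq> 0 \<Longrightarrow> track M i x \<in> contour M"
  by (auto simp: weight_def track_def contour_def base_segment_def linepath_in_path
           split: if_splits split_indicator_asm)

lemma contour_cases:
  assumes "\<zeta> \<in> contour M" "M > 0"
  obtains (branch) "Im \<zeta> \<ge> M" "\<bar>Re \<zeta>\<bar> = pi / (2 * Im \<zeta>)"
        | (base) "Im \<zeta> = M" "\<bar>Re \<zeta>\<bar> \<le> pi / (2 * M)"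
proof -
  consider "\<zeta> \<in> right_branch ` {M..} \<union> left_branch ` {M..}"
    | "\<zeta> \<in> closed_segment (right_branch M) (left_branch M)"
    using assms by (auto simp: contour_def)
  then show thesis
  proof cases
    case 1
    then have "Im \<zeta> \<ge> M" "\<bar>Re \<zeta>\<bar> = pi / (2 * Im \<zeta>)"
      using assms(2) by (auto simp: right_branch_def left_branch_def)
    then show thesis by (rule branch)
  next
    case 2
    then obtain u where u: "0 \<le> u" "u \<le> 1" "\<zeta> = (1 - u) *\<^sub>R right_branch M + u *\<^sub>R left_branch M"
      by (auto simp: closed_segment_def)
    have im: "Im \<zeta> = M"
      by (simp add: u(3) right_branch_def left_branch_def algebra_simps)
    have "Re \<zeta> = (1 - 2 * u) * (pi / (2 * M))"
      by (simp add: u(3) right_branch_def left_branch_def algebra_simps diff_divide_distrib)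
    also have "\<bar>\<dots>\<bar> \<le> 1 * (pi / (2 * M))"
      unfolding abs_mult using u assms(2) by (intro mult_mono) auto
    finally show thesis using base im by simp
  qed
qed

text \<open>The contour is widest at its base. As \<open>M\<close> grows the enclosing strip becomes
  arbitrarily thin, which is what later gives every exponential growth rate.\<close>

lemma contour_Re_bound:
  assumes "\<zeta> \<in> contour M" "M > 0"
  shows "\<bar>Re \<zeta>\<bar> \<le> pi / (2 * M)"
  using assms(1,2) by (cases rule: contour_cases) (use assms(2) in \<open>auto intro!: divide_left_mono\<close>)

text \<open>The decay is \<open>exp (- exp (x^2 - ...))\<close>, and already the bound
  \<open>exp y >= y\<close> makes it at least Gaussian, which beats \<open>exp (c * norm _)\<close>
  with a factor \<open>exp (- x)\<close> to spare.\<close>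

lemma branch_weight_integrable:
  assumes M: "M > 0" and c: "c \<ge> 0"
  shows "integrable lborel (\<lambda>x. indicator {M..} x *
           (norm (exp_exp (right_branch x) * right_tangent x) * exp (c * norm (right_branch x))))"
proof -
  \<comment> \<open>\<open>K\<close> bounds the real part and \<open>T\<close> the tangent on the
    branch; \<open>b\<close> is the resulting Gaussian rate, and \<open>A\<close> is the constant
    left over from completing the square.\<close>
  define K where "K = pi / (2 * M)"
  define b where "b = exp (- K\<^sup>2)"
  define A where "A = c * K + (c + 1)\<^sup>2 / (4 * b)"
  define T where "T = pi / (2 * M\<^sup>2) + 1"
  have pos: "K > 0" "b > 0" "T > 0" using M by (auto simp: K_def b_def T_def add_nonneg_pos)
  have bound: "norm (exp_exp (right_branch x) * right_tangent x) * exp (c * norm (right_branch x))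
      \<le> T * exp A * exp (- 1 * x)" if x: "x \<ge> M" for x
  proof -
    have x0: "x > 0" using M x by simp
    have Kx: "pi / (2 * x) \<le> K" using x M by (auto simp: K_def intro!: divide_left_mono)
    have "norm (right_branch x) \<le> \<bar>Re (right_branch x)\<bar> + \<bar>Im (right_branch x)\<bar>" by (rule cmod_le)
    also have "\<dots> \<le> K + x" using Kx x0 by (simp add: right_branch_def)
    finally have p: "norm (right_branch x) \<le> K + x" .
    have "norm (right_tangent x) \<le> \<bar>Re (right_tangent x)\<bar> + \<bar>Im (right_tangent x)\<bar>" by (rule cmod_le)
    also have "\<dots> = pi / (2 * x\<^sup>2) + 1" by (simp add: right_tangent_def)
    also have "\<dots> \<le> T"
      using x M by (auto simp: T_def intro!: divide_left_mono power_mono)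
    finally have t: "norm (right_tangent x) \<le> T" .
    have "b * x\<^sup>2 \<le> b * exp (x\<^sup>2)"
      using pos exp_ge_add_one_self[of "x\<^sup>2"] by (intro mult_left_mono) linarith+
    also have "\<dots> = exp (x\<^sup>2 - K\<^sup>2)" by (simp add: b_def exp_diff exp_minus field_simps)
    also have "\<dots> \<le> exp (x\<^sup>2 - (pi / (2 * x))\<^sup>2)"
      using Kx x0 by (simp only: exp_le_cancel_iff) (intro diff_left_mono power_mono, auto)
    finally have e: "b * x\<^sup>2 \<le> exp (x\<^sup>2 - (pi / (2 * x))\<^sup>2)" .
    \<comment> \<open>Completing the square with \<open>c + 1\<close> instead of \<open>c\<close>
      keeps one extra \<open>- x\<close> in the exponent.\<close>
    have "0 \<le> b * (x - (c + 1) / (2 * b))\<^sup>2" using pos by simp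
    also have "\<dots> = b * x\<^sup>2 - (c + 1) * x + (c + 1)\<^sup>2 / (4 * b)"
      using pos by (simp add: field_simps power2_eq_square)
    finally have "c * (K + x) - b * x\<^sup>2 \<le> A - x" by (simp add: A_def algebra_simps)
    moreover have "c * norm (right_branch x) \<le> c * (K + x)" using p c by (intro mult_left_mono)
    ultimately have E: "- exp (x\<^sup>2 - (pi / (2 * x))\<^sup>2) + c * norm (right_branch x) \<le> A - x"
      using e by linarith
    have "norm (exp_exp (right_branch x) * right_tangent x) * exp (c * norm (right_branch x))
       = norm (right_tangent x) * exp (- exp (x\<^sup>2 - (pi / (2 * x))\<^sup>2) + c * norm (right_branch x))"
      by (subst exp_exp_right_branch[OF x0]) (simp only: norm_mult norm_of_real abs_exp_cancel exp_add mult_ac)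
    also have "\<dots> \<le> T * exp (A - x)"
      using t E pos by (intro mult_mono) auto
    finally show ?thesis by (simp add: exp_diff exp_minus field_simps)
  qed
  show ?thesis
  proof (rule Bochner_Integration.integrable_bound)
    show "integrable lborel (\<lambda>x. T * exp A * (indicator {0<..} x *\<^sub>R exp (- 1 * x)))"
      by (intro integrable_mult_right exp_halfline_real) auto
    show "AE x in lborel. norm (indicator {M..} x *
           (norm (exp_exp (right_branch x) * right_tangent x) * exp (c * norm (right_branch x))))
        \<le> norm (T * exp A * (indicator {0<..} x *\<^sub>R exp (- 1 * x)))"
    proof (rule AE_I2)
      fix x :: real
      show "norm (indicator {M..} x *
           (norm (exp_exp (right_branch x) * right_tangent x) * exp (c * norm (right_branch x))))
        \<le> norm (T * exp A * (indicator {0<..} x *\<^sub>R exp (- 1 * x)))"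
        using bound[of x] M pos by (cases "x \<ge> M") (auto simp: abs_mult)
    qed
  qed measurable
qed

lemma weight_exp_integrable:
  assumes M: "M > 0" and c: "c \<ge> 0"
  shows "integrable lborel (\<lambda>x. norm (weight M i x) * exp (c * norm (track M i x)))"
proof -
  \<comment> \<open>Reflection preserves all norms involved, so the left branch has the same
    integrand as the right one; the segment is compact.\<close>
  have left: "norm (left_branch x) = norm (right_branch x)"
    "norm (left_tangent x) = norm (right_tangent x)" for x
    by (simp_all add: left_branch_eq left_tangent_eq)
  have left_e: "norm (exp_exp (left_branch x)) = norm (exp_exp (right_branch x))" if "x \<ge> M" for x
    using that M exp_exp_left_branch[of x] exp_exp_right_branch[of x] by simp
  consider "i = 0" | "i = 1" | "i \<noteq> 0" "i \<noteq> 1" by auto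
  then show ?thesis
  proof cases
    case 1
    then have "(\<lambda>x. norm (weight M i x) * exp (c * norm (track M i x))) =
       (\<lambda>x. indicator {M..} x * (norm (exp_exp (right_branch x) * right_tangent x) * exp (c * norm (right_branch x))))"
      by (auto simp: weight_def track_def fun_eq_iff indicator_def)
    then show ?thesis using branch_weight_integrable[OF M c] by simp
  next
    case 3
    then have "(\<lambda>x. norm (weight M i x) * exp (c * norm (track M i x))) =
       (\<lambda>x. indicator {M..} x * (norm (exp_exp (right_branch x) * right_tangent x) * exp (c * norm (right_branch x))))"
      by (auto simp: weight_def track_def fun_eq_iff indicator_def left left_e norm_mult)
    then show ?thesis using branch_weight_integrable[OF M c] by simp
  next
    case 2
    have "integrable lborel (\<lambda>x. indicator {0..1} x *\<^sub>R (norm (exp_exp (base_segment M x) *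
            (left_branch M - right_branch M)) * exp (c * norm (base_segment M x))))"
      unfolding base_segment_def exp_exp_def
      by (intro borel_integrable_compact continuous_intros) auto
    moreover have "(\<lambda>x. norm (weight M i x) * exp (c * norm (track M i x))) =
       (\<lambda>x. indicator {0..1} x *\<^sub>R (norm (exp_exp (base_segment M x) *
            (left_branch M - right_branch M)) * exp (c * norm (base_segment M x))))"
      using 2 by (auto simp: weight_def track_def fun_eq_iff indicator_def)
    ultimately show ?thesis by simp
  qed
qed

lemma weight_integrable: "M > 0 \<Longrightarrow> integrable lborel (weight M i)"
  using weight_exp_integrable[of M 0 i] by (subst integrable_norm_iff[symmetric]) auto

lemma weight_mult_integrable:
  assumes M: "M > 0" and c: "c \<ge> 0" and [measurable]: "h \<in> borel_measurable borel"
    and h: "\<And>\<zeta>. \<zeta> \<in> contour M \<Longrightarrow> norm (h \<zeta>) \<le> C * exp (c * norm \<zeta>)"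
  shows "integrable lborel (\<lambda>x. weight M i x * h (track M i x))"
proof (rule Bochner_Integration.integrable_bound)
  show "integrable lborel (\<lambda>x. C * (norm (weight M i x) * exp (c * norm (track M i x))))"
    by (intro integrable_mult_right weight_exp_integrable M c)
  show "AE x in lborel. norm (weight M i x * h (track M i x))
      \<le> norm (C * (norm (weight M i x) * exp (c * norm (track M i x))))"
  proof (rule AE_I2)
    fix x
    show "norm (weight M i x * h (track M i x))
      \<le> norm (C * (norm (weight M i x) * exp (c * norm (track M i x))))"
    proof (cases "weight M i x = 0")
      case False
      have "norm (weight M i x * h (track M i x)) \<le> norm (weight M i x) * (C * exp (c * norm (track M i x)))"
        unfolding norm_mult by (intro mult_left_mono h track_in_contour False) auto
      then show ?thesis
        by (metis abs_ge_self mult.left_commute order_trans real_norm_def)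
    qed simp
  qed
qed measurable

text \<open>The exponential bound on \<open>h\<close> makes all three pieces absolutely integrable,
  so the Henstock-Kurzweil integrals on the branches and the contour integral on the segment agree
  with Lebesgue integrals.\<close>

lemma
  assumes M: "M > 0" and c: "c \<ge> 0" and h: "h \<in> borel_measurable borel"
    "\<And>\<zeta>. \<zeta> \<in> contour M \<Longrightarrow> norm (h \<zeta>) \<le> C * exp (c * norm \<zeta>)"
  shows gamma_integrable_exp_exp: "gamma_integrable M (\<lambda>\<zeta>. exp_exp \<zeta> * h \<zeta>)"
    and gamma_integral_exp_exp: "gamma_integral M (\<lambda>\<zeta>. exp_exp \<zeta> * h \<zeta>) = gamma_average M h"
proof -
  note int = weight_mult_integrable[OF M c h]
  have vd: "vector_derivative right_branch (at x) = right_tangent x"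
     "vector_derivative left_branch (at x) = left_tangent x" if "x \<in> {M..}" for x
    using that M
    by (auto intro!: vector_derivative_at right_branch_has_vector_derivative left_branch_has_vector_derivative)
  have L: "set_integrable lborel {M..} (\<lambda>x. exp_exp (left_branch x) * h (left_branch x) * left_tangent x)"
    using int[of 2] by (simp add: set_integrable_def weight_def track_def mult_ac)
  have "integrable lborel (\<lambda>x. - (weight M 0 x * h (track M 0 x)))"
    using int[of 0] by simp
  then have R: "set_integrable lborel {M..} (\<lambda>x. exp_exp (right_branch x) * h (right_branch x) * right_tangent x)"
    by (simp add: set_integrable_def weight_def track_def mult_ac)
  have B: "set_integrable lborel {0..1} (\<lambda>x. exp_exp (base_segment M x) * h (base_segment M x) * (left_branch M - right_branch M))"
    using int[of 1] by (simp add: set_integrable_def weight_def track_def mult_ac)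
  have cong: "((\<lambda>x. exp_exp (right_branch x) * h (right_branch x) * vector_derivative right_branch (at x)) has_integral y) {M..}
      \<longleftrightarrow> ((\<lambda>x. exp_exp (right_branch x) * h (right_branch x) * right_tangent x) has_integral y) {M..}"
    "((\<lambda>x. exp_exp (left_branch x) * h (left_branch x) * vector_derivative left_branch (at x)) has_integral y) {M..}
      \<longleftrightarrow> ((\<lambda>x. exp_exp (left_branch x) * h (left_branch x) * left_tangent x) has_integral y) {M..}" for y
    by (intro has_integral_cong; simp add: vd)+
  \<comment> \<open>The minus sign undoes the orientation that is built into
    \<open>weight M 0\<close>.\<close>
  have R': "((\<lambda>x. exp_exp (right_branch x) * h (right_branch x) * vector_derivative right_branch (at x)) has_integral
       - (\<integral>x. weight M 0 x * h (track M 0 x) \<partial>lborel)) {M..}"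
    unfolding cong
    using set_borel_integral_eq_integral(1)[OF R, THEN integrable_integral]
      set_borel_integral_eq_integral(2)[OF R]
    by (simp add: set_lebesgue_integral_def weight_def track_def mult_ac)
  have L': "((\<lambda>x. exp_exp (left_branch x) * h (left_branch x) * vector_derivative left_branch (at x)) has_integral
       (\<integral>x. weight M 2 x * h (track M 2 x) \<partial>lborel)) {M..}"
    unfolding cong
    using set_borel_integral_eq_integral(1)[OF L, THEN integrable_integral]
      set_borel_integral_eq_integral(2)[OF L]
    by (simp add: set_lebesgue_integral_def weight_def track_def mult_ac)
  have B': "((\<lambda>\<zeta>. exp_exp \<zeta> * h \<zeta>) has_contour_integral
       (\<integral>x. weight M 1 x * h (track M 1 x) \<partial>lborel)) (base_segment M)"
  proof -
    have "(\<integral>x. weight M 1 x * h (track M 1 x) \<partial>lborel) = integral {0..1} (\<lambda>x.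
        exp_exp (base_segment M x) * h (base_segment M x) * (left_branch M - right_branch M))"
      unfolding set_borel_integral_eq_integral(2)[OF B, symmetric] set_lebesgue_integral_def
      by (intro Bochner_Integration.integral_cong) (simp_all add: weight_def track_def mult_ac)
    then show ?thesis
      using set_borel_integral_eq_integral(1)[OF B, THEN integrable_integral]
      unfolding base_segment_def has_contour_integral_linepath by simp
  qed
  show "gamma_integrable M (\<lambda>\<zeta>. exp_exp \<zeta> * h \<zeta>)"
    unfolding gamma_integrable_def branch_integrable_def
    using R' L' B' by (auto simp: has_contour_integral_integrable has_integral_integrable)
  show "gamma_integral M (\<lambda>\<zeta>. exp_exp \<zeta> * h \<zeta>) = gamma_average M h"
    unfolding gamma_integral_def branch_integral_def gamma_average_def
    using integral_unique[OF R'] integral_unique[OF L'] contour_integral_unique[OF B']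
    by (simp add: numeral_3_eq_3 numeral_2_eq_2)
qed

section \<open>The jump function\<close>

text \<open>The parameter \<open>z\<close> is complex so that the same integral later gives an
  entire function; the growth rate of the exponential along the contour is
  \<open>norm z\<close>.\<close>

lemma
  assumes "M > 0"
  shows gamma_integrable_exp: "gamma_integrable M (\<lambda>\<zeta>. exp_exp \<zeta> * exp (\<zeta> * z))"
    and gamma_integral_exp:
      "gamma_integral M (\<lambda>\<zeta>. exp_exp \<zeta> * exp (\<zeta> * z)) = gamma_average M (\<lambda>\<zeta>. exp (\<zeta> * z))"
    and weight_exp_mult_integrable:
      "integrable lborel (\<lambda>x. weight M i x * exp (track M i x * z))"
proof -
  have "norm (exp (\<zeta> * z)) \<le> 1 * exp (norm z * norm \<zeta>)" for \<zeta> :: complex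
    using norm_exp[of "\<zeta> * z"] by (simp add: norm_mult mult.commute)
  note * = assms norm_ge_zero[of z] _ this
  show "gamma_integrable M (\<lambda>\<zeta>. exp_exp \<zeta> * exp (\<zeta> * z))"
    by (rule gamma_integrable_exp_exp[OF *]) measurable
  show "gamma_integral M (\<lambda>\<zeta>. exp_exp \<zeta> * exp (\<zeta> * z)) = gamma_average M (\<lambda>\<zeta>. exp (\<zeta> * z))"
    by (rule gamma_integral_exp_exp[OF *]) measurable
  show "integrable lborel (\<lambda>x. weight M i x * exp (track M i x * z))"
    by (rule weight_mult_integrable[OF *]) measurable
qed

lemma holomorphic_gamma_average_exp:
  assumes M: "M > 0"
  shows "(\<lambda>z. gamma_average M (\<lambda>\<zeta>. exp (\<zeta> * z))) holomorphic_on UNIV"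
  unfolding gamma_average_def
proof (intro holomorphic_on_sum holomorphic_on_parameter_integral)
  fix i and z :: complex
  show "\<exists>r>0. \<exists>B. cball z r \<subseteq> UNIV \<and> integrable lborel B \<and>
          (\<forall>w\<in>cball z r. \<forall>x\<in>space lborel. norm (weight M i x * exp (track M i x * w)) \<le> B x)"
  proof (intro exI conjI ballI)
    \<comment> \<open>One majorant for the whole unit disc about \<open>z\<close>, on which
      \<open>norm w\<close> is at most \<open>norm z + 1\<close>.\<close>
    show "integrable lborel (\<lambda>x. norm (weight M i x) * exp ((norm z + 1) * norm (track M i x)))"
      by (intro weight_exp_integrable M) (simp add: add_nonneg_nonneg)
    fix w x assume "w \<in> cball z 1"
    then have "norm w \<le> norm z + 1"
      using norm_triangle_sub[of w z] by (simp add: dist_norm norm_minus_commute)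
    then have "norm (exp (track M i x * w)) \<le> exp ((norm z + 1) * norm (track M i x))"
      using norm_exp[of "track M i x * w"]
      by (smt (verit) exp_le_cancel_iff mult.commute mult_right_mono norm_ge_zero norm_mult)
    then show "norm (weight M i x * exp (track M i x * w))
        \<le> norm (weight M i x) * exp ((norm z + 1) * norm (track M i x))"
      by (simp add: norm_mult mult_left_mono)
  qed auto
qed (auto intro!: holomorphic_intros)

section \<open>Smoothness of restrictions of entire functions to the real line\<close>

lemma higher_vector_derivative_of_real:
  assumes "G holomorphic_on UNIV"
  shows "((\<lambda>k t. vector_derivative k (at t)) ^^ n) (\<lambda>t. G (of_real t)) = (\<lambda>t. (deriv ^^ n) G (of_real t))"
proof (induction n)
  case (Suc n)
  have "((\<lambda>t. (deriv ^^ n) G (of_real t)) has_vector_derivative (deriv ^^ Suc n) G (of_real t)) (at t)" for t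
    by (intro has_vector_derivative_real_field has_field_derivative_higher_deriv[OF assms]) auto
  from vector_derivative_at[OF this] show ?case by (simp add: Suc fun_eq_iff)
qed simp

lemma smooth_of_real_entire:
  assumes "G holomorphic_on UNIV"
  shows "smooth (\<lambda>t. G (of_real t))"
  unfolding smooth_def higher_vector_derivative_of_real[OF assms]
proof (intro allI differentiableI_vector[THEN differentiable_at_imp_differentiable_on] ballI)
  fix n t
  show "((\<lambda>t. (deriv ^^ n) G (of_real t)) has_vector_derivative (deriv ^^ Suc n) G (of_real t)) (at t)"
    by (intro has_vector_derivative_real_field has_field_derivative_higher_deriv[OF assms]) auto
qed

lemma jump_function_eq:
  assumes "M > 0"
  shows "jump_function M t = gamma_average M (\<lambda>\<zeta>. exp (\<zeta> * of_real t)) / (2 * of_real pi * \<i>)"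
  by (simp add: jump_function_def gamma_integral_exp[OF assms])

lemma smooth_jump_function:
  assumes "M > 0"
  shows "smooth (jump_function M)"
proof -
  have "(\<lambda>z. gamma_average M (\<lambda>\<zeta>. exp (\<zeta> * z)) / (2 * of_real pi * \<i>)) holomorphic_on UNIV"
    by (intro holomorphic_intros holomorphic_gamma_average_exp assms) auto
  from smooth_of_real_entire[OF this] show ?thesis
    by (simp add: jump_function_eq[OF assms, abs_def])
qed

lemma continuous_on_jump_function:
  assumes "M > 0"
  shows "continuous_on A (jump_function M)"
proof -
  have "jump_function M differentiable_on UNIV"
    using smooth_jump_function[OF assms] unfolding smooth_def by (metis funpow_0)
  then show ?thesis
    using differentiable_imp_continuous_on continuous_on_subset by blast
qed

section \<open>Independence of the height of the contour\<close>

lemma branch_integral_split: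
  assumes "M > 0" "M \<le> N"
    and p: "\<And>x A. x > 0 \<Longrightarrow> (p has_vector_derivative p' x) (at x within A)"
    and H: "\<And>z. (H has_field_derivative h z) (at z)"
    and N: "branch_integrable N p h"
  shows "branch_integral M p h = H (p N) - H (p M) + branch_integral N p h"
proof -
  have "((\<lambda>x. h (p x) * vector_derivative p (at x)) has_integral (H \<circ> p) N - (H \<circ> p) M) {M..N}"
  proof (rule fundamental_theorem_of_calculus[OF assms(2)])
    fix x assume "x \<in> {M..N}"
    then have x: "x > 0" using assms by auto
    have "((H \<circ> p) has_vector_derivative p' x * h (p x)) (at x)"
      by (intro field_vector_diff_chain_at p x H)
    moreover have "vector_derivative p (at x) = p' x" by (intro vector_derivative_at p x)
    ultimately show "((H \<circ> p) has_vector_derivative h (p x) * vector_derivative p (at x)) (at x within {M..N})"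
      by (simp add: mult.commute has_vector_derivative_at_within)
  qed
  moreover have "((\<lambda>x. h (p x) * vector_derivative p (at x)) has_integral branch_integral N p h) {N..}"
    using N unfolding branch_integrable_def branch_integral_def by (rule integrable_integral)
  ultimately have "((\<lambda>x. h (p x) * vector_derivative p (at x)) has_integral
      (H \<circ> p) N - (H \<circ> p) M + branch_integral N p h) ({M..N} \<union> {N..})"
  proof (rule has_integral_Un)
    have "{M..N} \<inter> {N..} = {N}" using assms(2) by auto
    then show "negligible ({M..N} \<inter> {N..})" by simp
  qed
  moreover have "{M..N} \<union> {N..} = {M..}" using assms(2) by auto
  ultimately show ?thesis
    unfolding branch_integral_def by (simp add: integral_unique)
qed

text \<open>An entire \<open>h\<close> has a primitive \<open>H\<close>. The values of
  \<open>H\<close> at the lower corners cancel against those from the lower segment, and the values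
  at the upper corners add up to the upper segment.\<close>

lemma gamma_integral_shift:
  assumes "0 < M" "M \<le> N" and h: "h holomorphic_on UNIV" and N: "gamma_integrable N h"
  shows "gamma_integral M h = gamma_integral N h"
proof -
  obtain H where H: "\<And>z. (H has_field_derivative h z) (at z)"
    using holomorphic_convex_primitive'[OF convex_UNIV open_UNIV h] by auto
  have base: "contour_integral (base_segment K) h = H (left_branch K) - H (right_branch K)" for K
    using contour_integral_primitive[of UNIV H h "base_segment K"] H
    by (auto simp: base_segment_def intro!: contour_integral_unique)
  show ?thesis
    using branch_integral_split[OF assms(1,2) right_branch_has_vector_derivative H]
      branch_integral_split[OF assms(1,2) left_branch_has_vector_derivative H] N
    by (simp add: gamma_integral_def gamma_integrable_def base)
qed

lemma jump_function_independent:
  assumes "M > 0" "N > 0"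
  shows "jump_function M t = jump_function N t"
proof -
  have le: "jump_function M t = jump_function N t" if "0 < M" "M \<le> N" for M N
  proof -
    have "gamma_integrable N (\<lambda>\<zeta>. exp_exp \<zeta> * exp (\<zeta> * of_real t))"
      using that by (intro gamma_integrable_exp) auto
    moreover have "(\<lambda>\<zeta>. exp_exp \<zeta> * exp (\<zeta> * of_real t)) holomorphic_on UNIV"
      by (intro holomorphic_intros)
    ultimately show ?thesis
      unfolding jump_function_def using gamma_integral_shift[OF that] by simp
  qed
  show ?thesis
  proof (rule linorder_le_cases[of M N])
    show "jump_function M t = jump_function N t" if "M \<le> N" using le[OF assms(1) that] .
    show "jump_function M t = jump_function N t" if "N \<le> M" using le[OF assms(2) that] by (rule sym)
  qed
qed

text \<open>Supremum on the contour times total mass of the weights; used both for the growth of the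
  jump function and for the size of \<open>I_integral\<close> on the imaginary axis.\<close>

lemma norm_gamma_average_le:
  assumes M: "M > 0" and h[measurable]: "h \<in> borel_measurable borel"
    and K: "\<And>\<zeta>. \<zeta> \<in> contour M \<Longrightarrow> norm (h \<zeta>) \<le> K"
  shows "norm (gamma_average M h) \<le> (\<Sum>i<3. \<integral>x. norm (weight M i x) \<partial>lborel) * K"
  unfolding gamma_average_def sum_distrib_right
proof (intro sum_norm_le)
  fix i
  have le: "norm (weight M i x * h (track M i x)) \<le> norm (weight M i x) * K" for x
    using K[OF track_in_contour, of i x] by (cases "weight M i x = 0") (auto simp: norm_mult intro!: mult_left_mono)
  have "norm (\<integral>x. weight M i x * h (track M i x) \<partial>lborel) \<le> (\<integral>x. norm (weight M i x) * K \<partial>lborel)"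
  proof (rule Bochner_Integration.integral_norm_bound_integral)
    show "integrable lborel (\<lambda>x. weight M i x * h (track M i x))"
      using K by (intro weight_mult_integrable[OF M, of 0 h K]) auto
  qed (use weight_integrable[OF M] le in auto)
  then show "norm (\<integral>x. weight M i x * h (track M i x) \<partial>lborel) \<le> (\<integral>x. norm (weight M i x) \<partial>lborel) * K"
    by simp
qed

lemma jump_function_growth:
  assumes "M > 0" "c > 0"
  shows "\<exists>C. \<forall>t. norm (jump_function M t) \<le> C * exp (c * \<bar>t\<bar>)"
proof -
  \<comment> \<open>The height at which the strip around the contour has half-width exactly
    \<open>c\<close>. The jump function is evaluated on that contour, so \<open>C\<close> depends on
    \<open>c\<close> but not on \<open>t\<close>.\<close>
  define N where "N = pi / (2 * c)"
  have N: "N > 0" "pi / (2 * N) = c" using assms(2) by (auto simp: N_def)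
  define C where "C = (\<Sum>i<3. \<integral>x. norm (weight N i x) \<partial>lborel) / (2 * pi)"
  have "norm (jump_function M t) \<le> C * exp (c * \<bar>t\<bar>)" for t
  proof -
    have "norm (exp (\<zeta> * of_real t)) \<le> exp (c * \<bar>t\<bar>)" if "\<zeta> \<in> contour N" for \<zeta>
    proof -
      have "Re \<zeta> * t \<le> \<bar>Re \<zeta>\<bar> * \<bar>t\<bar>" by (metis abs_ge_self abs_mult)
      also have "\<dots> \<le> c * \<bar>t\<bar>" using contour_Re_bound[OF that N(1)] N(2) by (intro mult_right_mono) auto
      finally show ?thesis by simp
    qed
    from norm_gamma_average_le[OF N(1) _ this]
    have "norm (gamma_average N (\<lambda>\<zeta>. exp (\<zeta> * of_real t))) / (2 * pi) \<le> C * exp (c * \<bar>t\<bar>)"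
      by (simp add: C_def divide_right_mono)
    then show ?thesis
      by (simp add: jump_function_independent[OF assms(1) N(1)] jump_function_eq[OF N(1)] norm_divide norm_mult)
  qed
  then show ?thesis by blast
qed

section \<open>The Cauchy transform of the contour\<close>

text \<open>A positive distance \<open>d\<close> from the contour bounds the Cauchy kernel by
  \<open>1 / d\<close>, so the comparison with \<open>gamma_average\<close> applies with growth rate
  0.\<close>

lemma I_integral_eq:
  assumes M: "M > 0" and d: "d > 0" "\<And>\<zeta>. \<zeta> \<in> contour M \<Longrightarrow> norm (s - \<zeta>) \<ge> d"
  shows "I_integral M s = gamma_average M (\<lambda>\<zeta>. 1 / (s - \<zeta>)) / (2 * of_real pi * \<i>)"
proof -
  have "gamma_integral M (\<lambda>\<zeta>. exp_exp \<zeta> * (1 / (s - \<zeta>))) = gamma_average M (\<lambda>\<zeta>. 1 / (s - \<zeta>))"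
  proof (rule gamma_integral_exp_exp[OF M, of 0 _ "1 / d"])
    show "norm (1 / (s - \<zeta>)) \<le> 1 / d * exp (0 * norm \<zeta>)" if "\<zeta> \<in> contour M" for \<zeta>
      using d(2)[OF that] d(1) by (simp add: norm_divide frac_le)
  qed auto
  then show ?thesis by (simp add: I_integral_def)
qed

text \<open>To the right of the strip, \<open>laplace_exp_average\<close> applies to each of the
  three pieces with \<open>c = pi / (2 * M)\<close>; the sum is then taken back inside the
  integral.\<close>

lemma I_integral_eq_laplace_right:
  assumes M: "M > 0" and s: "Re s > pi / (2 * M)"
  shows "I_integral M s = (\<integral>t. indicator {0<..} t *\<^sub>R (exp (- s * of_real t) * jump_function M t) \<partial>lborel)"
proof -
  have "I_integral M s = gamma_average M (\<lambda>\<zeta>. 1 / (s - \<zeta>)) / (2 * of_real pi * \<i>)"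
  proof (rule I_integral_eq[OF M])
    show "Re s - pi / (2 * M) > 0" using s by simp
    show "norm (s - \<zeta>) \<ge> Re s - pi / (2 * M)" if "\<zeta> \<in> contour M" for \<zeta>
      using contour_Re_bound[OF that M] abs_Re_le_cmod[of "s - \<zeta>"] by auto
  qed
  also have "gamma_average M (\<lambda>\<zeta>. 1 / (s - \<zeta>)) = (\<Sum>i<3. \<integral>t. indicator {0<..} t *\<^sub>R
      (exp (- s * of_real t) * (\<integral>x. weight M i x * exp (track M i x * of_real t) \<partial>lborel)) \<partial>lborel)"
    unfolding gamma_average_def times_divide_eq_right mult_1_right
  proof (intro sum.cong refl laplace_exp_average(2)[OF _ _ _ s, symmetric] weight_integrable M)
    show "Re (track M i x) \<le> pi / (2 * M)" if "weight M i x \<noteq> 0" for i x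
      using contour_Re_bound[OF track_in_contour[OF that] M] by auto
  qed measurable
  also have "\<dots> = (\<integral>t. (\<Sum>i<3. indicator {0<..} t *\<^sub>R
      (exp (- s * of_real t) * (\<integral>x. weight M i x * exp (track M i x * of_real t) \<partial>lborel))) \<partial>lborel)"
  proof (intro Bochner_Integration.integral_sum[symmetric] laplace_exp_average(1)[OF _ _ _ s] weight_integrable M)
    show "Re (track M i x) \<le> pi / (2 * M)" if "weight M i x \<noteq> 0" for i x
      using contour_Re_bound[OF track_in_contour[OF that] M] by auto
  qed measurable
  also have "\<dots> = (\<integral>t. indicator {0<..} t *\<^sub>R (exp (- s * of_real t) * gamma_average M (\<lambda>\<zeta>. exp (\<zeta> * of_real t))) \<partial>lborel)"
    by (simp add: gamma_average_def sum_distrib_left scaleR_sum_right)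
  finally show ?thesis
    unfolding jump_function_eq[OF M] integral_divide_zero[symmetric]
    by (simp add: scaleR_conv_of_real)
qed

text \<open>The same argument for \<open>- s\<close> and the negated tracks, since
  \<open>1 / (s - p) = - 1 / (- s - - p)\<close>. This produces both the outer minus sign and the
  reflected argument \<open>- t\<close>.\<close>

lemma I_integral_eq_laplace_left:
  assumes M: "M > 0" and s: "Re s < - pi / (2 * M)"
  shows "I_integral M s = - (\<integral>t. indicator {0<..} t *\<^sub>R (exp (s * of_real t) * jump_function M (- t)) \<partial>lborel)"
proof -
  have Re_neg: "Re (- track M i x) \<le> pi / (2 * M)" if "weight M i x \<noteq> 0" for i x
    using contour_Re_bound[OF track_in_contour[OF that] M] by auto
  have s': "pi / (2 * M) < Re (- s)" using s by simp
  have "I_integral M s = gamma_average M (\<lambda>\<zeta>. 1 / (s - \<zeta>)) / (2 * of_real pi * \<i>)"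
  proof (rule I_integral_eq[OF M])
    show "Re (- s) - pi / (2 * M) > 0" using s' by simp
    show "norm (s - \<zeta>) \<ge> Re (- s) - pi / (2 * M)" if "\<zeta> \<in> contour M" for \<zeta>
      using contour_Re_bound[OF that M] abs_Re_le_cmod[of "s - \<zeta>"] by auto
  qed
  also have "gamma_average M (\<lambda>\<zeta>. 1 / (s - \<zeta>)) = - (\<Sum>i<3. \<integral>x. weight M i x / (- s - - track M i x) \<partial>lborel)"
  proof -
    have "w * (1 / (s - p)) = - (w / (- s - - p))" for w p
    proof -
      have "- s - - p = - (s - p)" by simp
      then show ?thesis by (simp only: divide_minus_right minus_minus times_divide_eq_right mult_1_right)
    qed
    then show ?thesis by (simp only: gamma_average_def sum_negf integral_minus)
  qed
  also have "\<dots> = - (\<Sum>i<3. \<integral>t. indicator {0<..} t *\<^sub>R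
      (exp (- (- s) * of_real t) * (\<integral>x. weight M i x * exp (- track M i x * of_real t) \<partial>lborel)) \<partial>lborel)"
    by (intro arg_cong[of _ _ uminus] sum.cong refl laplace_exp_average(2)[OF _ _ _ s', symmetric]
          weight_integrable M Re_neg) measurable
  also have "\<dots> = - (\<integral>t. (\<Sum>i<3. indicator {0<..} t *\<^sub>R
      (exp (- (- s) * of_real t) * (\<integral>x. weight M i x * exp (- track M i x * of_real t) \<partial>lborel))) \<partial>lborel)"
    by (intro arg_cong[of _ _ uminus] Bochner_Integration.integral_sum[symmetric]
          laplace_exp_average(1)[OF _ _ _ s'] weight_integrable M Re_neg) measurable
  also have "\<dots> = - (\<integral>t. indicator {0<..} t *\<^sub>R (exp (s * of_real t) * gamma_average M (\<lambda>\<zeta>. exp (\<zeta> * of_real (- t)))) \<partial>lborel)"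
    by (simp add: gamma_average_def sum_distrib_left scaleR_sum_right)
  finally show ?thesis
    unfolding jump_function_eq[OF M] integral_minus[symmetric] integral_divide_zero[symmetric]
    by (simp add: scaleR_conv_of_real)
qed

lemma I_integral_imaginary_axis_growth:
  assumes M: "M > 0"
  shows "\<exists>C\<ge>0. \<forall>\<sigma>\<ge>M+1. norm (I_integral M (Complex 0 \<sigma>)) \<le> C * (\<sigma> + 1)"
proof -
  define C where "C = (\<Sum>i<3. \<integral>x. norm (weight M i x) \<partial>lborel) / (2 * pi)"
  have "C \<ge> 0" by (auto simp: C_def intro!: divide_nonneg_nonneg sum_nonneg)
  moreover have "norm (I_integral M (Complex 0 \<sigma>)) \<le> C * (\<sigma> + 1)" if \<sigma>: "\<sigma> \<ge> M + 1" for \<sigma>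
  proof -
    \<comment> \<open>On a branch up to height \<open>\<sigma> + 1\<close> the horizontal distance
      \<open>pi / (2 * Im \<zeta>)\<close> suffices; higher up, and on the base, the vertical
      distance is at least 1.\<close>
    have d: "norm (Complex 0 \<sigma> - \<zeta>) \<ge> 1 / (\<sigma> + 1)" if \<zeta>: "\<zeta> \<in> contour M" for \<zeta>
    proof -
      have le1: "1 / (\<sigma> + 1) \<le> 1" using \<sigma> M by simp
      have re: "\<bar>Re \<zeta>\<bar> \<le> norm (Complex 0 \<sigma> - \<zeta>)" using abs_Re_le_cmod[of "Complex 0 \<sigma> - \<zeta>"] by simp
      have im: "\<bar>\<sigma> - Im \<zeta>\<bar> \<le> norm (Complex 0 \<sigma> - \<zeta>)" using abs_Im_le_cmod[of "Complex 0 \<sigma> - \<zeta>"] by simp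
      from \<zeta> M show ?thesis
      proof (cases rule: contour_cases)
        case branch
        show ?thesis
        proof (cases "Im \<zeta> \<le> \<sigma> + 1")
          case True
          have "1 / (\<sigma> + 1) \<le> 1 / Im \<zeta>" using True branch(1) M by (intro divide_left_mono) auto
          also have "\<dots> \<le> pi / (2 * Im \<zeta>)"
            using branch(1) M pi_ge_two by (simp add: field_simps)
          finally show ?thesis using re branch(2) by simp
        next
          case False
          then show ?thesis using im le1 by linarith
        qed
      next
        case base
        then show ?thesis using im le1 \<sigma> by linarith
      qed
    qed
    have pos: "1 / (\<sigma> + 1) > 0" using \<sigma> M by simp
    have "norm (1 / (Complex 0 \<sigma> - \<zeta>)) \<le> \<sigma> + 1" if "\<zeta> \<in> contour M" for \<zeta>
      using frac_le[OF _ _ pos d[OF that], of 1 1] by (simp add: norm_divide)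
    from norm_gamma_average_le[OF M _ this]
    have "norm (gamma_average M (\<lambda>\<zeta>. 1 / (Complex 0 \<sigma> - \<zeta>))) / (2 * pi) \<le> C * (\<sigma> + 1)"
      by (simp add: C_def divide_right_mono)
    then show ?thesis
      by (simp add: I_integral_eq[OF M pos d] norm_divide norm_mult)
  qed
  ultimately show ?thesis by blast
qed

section \<open>The Laplace pair\<close>

lemma locally_integrable_halfline:
  assumes g: "continuous_on UNIV g" and A: "A \<in> sets borel"
  shows "locally_integrable (\<lambda>t. indicator A t *\<^sub>R g t)"
  unfolding locally_integrable_def
proof (intro allI impI)
  fix K :: "real set" assume K: "compact K"
  then obtain a b where ab: "K \<subseteq> {a..b}"
    by (metis bounded_subset_cbox_symmetric compact_imp_bounded box_real(2))
  have "g absolutely_integrable_on {a..b}"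
    using g by (intro absolutely_integrable_continuous_real) (rule continuous_on_subset, auto)
  moreover have "K \<inter> A \<in> sets lebesgue"
    using compact_imp_closed[OF K] A by (simp add: sets.Int borel_closed)
  ultimately have "g absolutely_integrable_on (K \<inter> A)"
    by (rule set_integrable_subset) (use ab in auto)
  then show "(\<lambda>t. indicator A t *\<^sub>R g t) absolutely_integrable_on K"
    by (simp only: set_integrable_def indicator_inter_arith scaleR_scaleR)
qed

text \<open>A closed strip containing the region contains its closure, so outside the strip
  \<open>F\<close> is given by \<open>I_integral\<close> alone.\<close>

lemma closure_D_region_subset:
  assumes "M > 0"
  shows "closure (D_region M) \<subseteq> {z. Re z \<le> pi / (2 * M)} \<inter> {z. Re z \<ge> - pi / (2 * M)}"
proof (rule closure_minimal)
  have "\<bar>Re z\<bar> \<le> pi / (2 * M)" if "z \<in> D_region M" for z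
  proof -
    have "pi / (2 * Im z) \<le> pi / (2 * M)"
      using that assms by (intro divide_left_mono) (auto simp: D_region_def)
    with that show ?thesis by (simp add: D_region_def)
  qed
  then show "D_region M \<subseteq> {z. Re z \<le> pi / (2 * M)} \<inter> {z. Re z \<ge> - pi / (2 * M)}"
    by (fastforce simp: abs_le_iff)
  show "closed ({z. Re z \<le> pi / (2 * M)} \<inter> {z. Re z \<ge> - pi / (2 * M)})"
    by (intro closed_Int closed_halfspace_Re_le closed_halfspace_Re_ge)
qed

lemma entire_extension_outside:
  assumes "M > 0" "entire_extension M F" "\<bar>Re s\<bar> > pi / (2 * M)"
  shows "F s = I_integral M s"
  using assms closure_D_region_subset[OF assms(1)] unfolding entire_extension_def by fastforce

lemma entire_extension_laplace_right:
  assumes M: "M > 0" and F: "entire_extension M F" and s: "Re s > 0"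
  defines "f \<equiv> \<lambda>t. indicator {0<..} t *\<^sub>R jump_function M t"
  shows "laplace_converges f s" "F s = laplace f s"
proof -
  have m: "f \<in> borel_measurable borel"
    unfolding f_def using borel_measurable_continuous_onI[OF continuous_on_jump_function[OF M]] by measurable
  have neg: "f t = 0" if "t < 0" for t using that by (simp add: f_def)
  have growth: "\<exists>C. \<forall>t>0. norm (f t) \<le> C * exp (c * t)" if "c > 0" for c
    using jump_function_growth[OF M that] by (auto simp: f_def) (metis abs_of_pos)
  have hol: "F holomorphic_on UNIV" using F by (simp add: entire_extension_def)
  have id: "F s = laplace f s" if "Re s > pi / (2 * M)" for s
    using that entire_extension_outside[OF M F, of s]
    by (subst laplace_eq_lborel[OF m]) (simp add: I_integral_eq_laplace_right[OF M] f_def)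
  show "laplace_converges f s" "F s = laplace f s"
    using laplace_identity_halfplane[OF m neg growth hol id s] by auto
qed

text \<open>The result for the right half-plane is applied to \<open>F (- z)\<close> and the
  time-reversed function \<open>r\<close>, and then carried back by the substitution of
  \<open>- t\<close> for \<open>t\<close>.\<close>

lemma entire_extension_laplace_left:
  assumes M: "M > 0" and F: "entire_extension M F" and s: "Re s < 0"
  defines "f \<equiv> \<lambda>t. indicator {..0} t *\<^sub>R - jump_function M t"
  shows "laplace_converges f s" "F s = laplace f s"
proof -
  have J[measurable]: "jump_function M \<in> borel_measurable borel"
    by (intro borel_measurable_continuous_onI continuous_on_jump_function M)
  have m[measurable]: "f \<in> borel_measurable borel" unfolding f_def by measurable
  define r where "r = (\<lambda>t. f (- t))"
  have mr[measurable]: "r \<in> borel_measurable borel" unfolding r_def by measurable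
  have neg: "r t = 0" if "t < 0" for t using that by (simp add: r_def f_def)
  have growth: "\<exists>C. \<forall>t>0. norm (r t) \<le> C * exp (c * t)" if "c > 0" for c
    using jump_function_growth[OF M that] by (auto simp: r_def f_def) (metis abs_minus_cancel abs_of_pos)
  have hol: "(\<lambda>z. F (- z)) holomorphic_on UNIV"
    using holomorphic_on_compose_gen[OF holomorphic_on_minus[OF holomorphic_on_ident], of F UNIV UNIV] F
    by (simp add: entire_extension_def o_def)
  have id: "F (- z) = laplace r z" if z: "Re z > pi / (2 * M)" for z
  proof -
    have "laplace r z = (\<integral>t. exp (- z * of_real t) * r t \<partial>lborel)"
      by (rule laplace_eq_lborel[OF mr])
    also have "\<dots> = (\<integral>t. - (indicator {0<..} t *\<^sub>R (exp (- z * of_real t) * jump_function M (- t))) \<partial>lborel)"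
    proof (rule integral_cong_AE)
      \<comment> \<open>\<open>f\<close> keeps its value at 0 whereas the integral formula is over
        \<open>{0<..}\<close>, so the two integrands may differ at the origin.\<close>
      have "AE t in lborel. t \<noteq> (0::real)" by (rule AE_lborel_singleton)
      then show "AE t in lborel. exp (- z * of_real t) * r t =
          - (indicator {0<..} t *\<^sub>R (exp (- z * of_real t) * jump_function M (- t)))"
        by eventually_elim (auto simp: r_def f_def indicator_def)
    qed measurable
    also have "\<dots> = I_integral M (- z)"
      using I_integral_eq_laplace_left[OF M, of "- z"] z by simp
    also have "\<dots> = F (- z)"
      using entire_extension_outside[OF M F, of "- z"] z by simp
    finally show ?thesis by simp
  qed
  have s': "Re (- s) > 0" using s by simp
  note * = laplace_identity_halfplane[OF mr neg growth hol id s']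
  \<comment> \<open>The shape \<open>0 + - 1 * t\<close> matches affine substitution for
    \<open>lborel\<close>, which transports both integrability and the value of the
    integral.\<close>
  have reflect: "exp (- (- s) * of_real t) * r t = exp (- s * of_real (0 + - 1 * t)) * f (0 + - 1 * t)" for t
    by (simp add: r_def)
  show "laplace_converges f s"
    using *(1) lborel_integrable_real_affine_iff[of "-1" "\<lambda>t. exp (- s * of_real t) * f t" 0]
    unfolding laplace_converges_iff_lborel[OF m] laplace_converges_iff_lborel[OF mr] reflect by simp
  have "F s = laplace r (- s)" using *(2) by simp
  also have "\<dots> = laplace f s"
    unfolding laplace_eq_lborel[OF m] laplace_eq_lborel[OF mr] reflect
    by (subst (2) lborel_integral_real_affine[where c = "-1" and t = 0]) simp_all
  finally show "F s = laplace f s" .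
qed

section \<open>Non-vanishing of the extension and of the jump\<close>

lemma entire_extension_nonzero:
  assumes M: "M > 0" and F: "entire_extension M F"
  shows "\<exists>s. F s \<noteq> 0"
proof (rule ccontr)
  assume "\<not> ?thesis"
  then have F0: "F s = 0" for s by auto
  obtain C where C: "C \<ge> 0" "\<And>\<sigma>. \<sigma> \<ge> M + 1 \<Longrightarrow> norm (I_integral M (Complex 0 \<sigma>)) \<le> C * (\<sigma> + 1)"
    using I_integral_imaginary_axis_growth[OF M] by blast
  \<comment> \<open>At least \<open>M + 1\<close>, so that the linear bound applies, and at least
    \<open>C + 1\<close>, so that \<open>2 + \<sigma>^2\<close> exceeds
    \<open>C * (\<sigma> + 1)\<close>.\<close>
  define \<sigma> where "\<sigma> = M + C + 1"
  have \<sigma>: "\<sigma> \<ge> M + 1" "\<sigma> \<ge> C + 1" "\<sigma> > 0" using M C by (auto simp: \<sigma>_def)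
  have "Complex 0 \<sigma> \<in> D_region M" using \<sigma> by (simp add: D_region_def)
  then have "I_integral M (Complex 0 \<sigma>) = exp_exp (Complex 0 \<sigma>)"
    using F F0 unfolding entire_extension_def by force
  also have "\<dots> = of_real (exp (exp (\<sigma>\<^sup>2)))"
  proof -
    have "- (Complex 0 \<sigma> ^ 2) = of_real (\<sigma>\<^sup>2)" by (simp add: complex_eq_iff power2_eq_square)
    then show ?thesis by (simp only: exp_exp_def exp_of_real)
  qed
  finally have "exp (exp (\<sigma>\<^sup>2)) \<le> C * (\<sigma> + 1)"
    using C(2)[OF \<sigma>(1)] by simp
  moreover have "exp (exp (\<sigma>\<^sup>2)) \<ge> 2 + \<sigma>\<^sup>2"
    using exp_ge_add_one_self[of "exp (\<sigma>\<^sup>2)"] exp_ge_add_one_self[of "\<sigma>\<^sup>2"] by linarith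
  moreover have "\<sigma>\<^sup>2 \<ge> (C + 1) * \<sigma>"
    using \<sigma> by (simp add: power2_eq_square mult_right_mono)
  ultimately show False using \<sigma> by (simp add: algebra_simps)
qed

lemma jump_function_nonzero:
  assumes M: "M > 0" and F: "entire_extension M F"
  shows "emeasure lebesgue {t. jump_function M t \<noteq> 0} > 0"
proof (rule ccontr)
  assume "\<not> ?thesis"
  then have "emeasure lebesgue {t. jump_function M t \<noteq> 0} = 0" by simp
  \<comment> \<open>Openness supplies measurability. It matters because \<open>emeasure\<close> is 0
    by default on non-measurable sets, so the value 0 alone would not make this a null set.\<close>
  moreover have "open {t. jump_function M t \<noteq> 0}"
    using continuous_on_jump_function[OF M] by (intro open_Collect_neq continuous_intros) auto
  ultimately have ae: "AE t in lebesgue. jump_function M t = 0"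
    by (intro AE_I[of _ _ "{t. jump_function M t \<noteq> 0}"]) auto
  have "F s = 0" if "Re s > 0" for s
    using ae unfolding entire_extension_laplace_right(2)[OF M F that] laplace_def
    by (intro integral_eq_zero_AE) (auto elim: eventually_mono)
  moreover have "F holomorphic_on UNIV" using F by (simp add: entire_extension_def)
  moreover have "{s. Re s > 0} \<noteq> {}" by (auto intro!: exI[of _ 1])
  ultimately have "F s = 0" for s
    by (intro analytic_continuation_open[of "{s. Re s > 0}" UNIV F "\<lambda>_. 0" s] open_halfspace_Re_gt connected_UNIV) simp_all
  then show False using entire_extension_nonzero[OF M F] by simp
qed

theorem theorem6p4:
  fixes M :: real and F :: "complex \<Rightarrow> complex"
  assumes "M > 0"
    and "entire_extension M F"
  shows "(\<forall>t. gamma_integrable M (\<lambda>\<zeta>. exp_exp \<zeta> * exp (\<zeta> * of_real t))) \<and>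
    smooth (jump_function M) \<and>
    (\<exists>f_l f_r. laplace_pair F f_l f_r \<and> ghost_transition F f_l f_r \<and>
       (\<forall>t. f_r t - f_l t = jump_function M t))"
proof (intro conjI exI allI)
  \<comment> \<open>The two half-lines partition the real line, so the difference is the jump
    function at every \<open>t\<close>, including 0.\<close>
  let ?l = "\<lambda>t. indicator {..0} t *\<^sub>R - jump_function M t"
  let ?r = "\<lambda>t. indicator {0<..} t *\<^sub>R jump_function M t"
  show "gamma_integrable M (\<lambda>\<zeta>. exp_exp \<zeta> * exp (\<zeta> * of_real t))" for t
    using assms(1) by (rule gamma_integrable_exp)
  show "smooth (jump_function M)" using assms(1) by (rule smooth_jump_function)
  show pair: "laplace_pair F ?l ?r"
    unfolding laplace_pair_def
    using assms entire_extension_laplace_left[OF assms] entire_extension_laplace_right[OF assms]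
    by (auto simp: entire_extension_def intro!: locally_integrable_halfline
          continuous_on_jump_function continuous_on_minus simp del: scaleR_minus_right)
  show jump: "?r t - ?l t = jump_function M t" for t
    by (auto simp: indicator_def)
  show "ghost_transition F ?l ?r"
    unfolding ghost_transition_def jump using pair jump_function_nonzero[OF assms] by simp
qed

end
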